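(* Let $0<a\le2$, $\mathbf z\in\mathbb C^n\setminus\{\mathbf 0\}$, $C>1$ a constant, and $s$ a non-negative integer. Let $$W_{\mathbf z}=\left\{\mathbf x\in\mathbf S^n: C\,\frac{\Re(\mathbf x\cdot\mathbf z)}{|\mathbf z|}\ge1\right\},\qquad V_{\mathbf z}=\mathbf S^n\setminus W_{\mathbf z}.$$ Then, as $\hbar\searrow0$, $$g_a^{(s)}\!\left(\frac{\mathbf x\cdot\mathbf z}{\hbar}\right)=\sqrt a\left[\frac{\mathbf x\cdot\mathbf z}{\hbar}\right]^{\frac12}e^{\frac{\mathbf x\cdot\mathbf z}{\hbar}}\left[1+\frac{a_{1,s}}{\mathbf x\cdot\mathbf z}\hbar+\mathrm O(\hbar^2)\right]\quad\text{for }\mathbf x\in W_{\mathbf z},$$ $$\left|g_a^{(s)}\!\left(\frac{\mathbf x\cdot\mathbf z}{\hbar}\right)\right|\le\frac{C_1}{\hbar}\,e^{|\mathbf z|/\hbar}\,e^{\mu|\mathbf z|/\hbar}\left(\frac{|\mathbf z|}{\hbar}+1\right)\quad\text{for }\mathbf x\in V_{\mathbf z},$$ with $C_1$ a constant (independent of $\mathbf x$ and $\hbar$) and $\mu=\frac1C-1<0$, where $a_{1,s}$ is the constant (depending only on $a$ and $s$) that appears as the coefficient of $z^{-1}$ in the asymptotic expansion $g_a^{(s)}(z)=\sqrt a\,z^{1/2}e^z\left[1+\frac{a_{1,s}}z+\mathrm O(z^{-2})\right]$ as $\Re(z)\to+\infty$ with $|\Im(z)|\le C\,\Re(z)$. In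 particular, if $n\ge2$, then for $\mathbf x\in W_{\mathbf z}$, as $\hbar\searrow0$, $$\mathbf K^\hbar_{n,-1}(\mathbf x,\mathbf z)=\left[\frac{\mathbf x\cdot\mathbf z}{\hbar(n-1)}\right]^{\frac12}\exp\!\left(\frac{\mathbf x\cdot\mathbf z}{\hbar}\right)\left[1+\frac{a_1}{\mathbf x\cdot\mathbf z}\hbar+\mathrm O(\hbar^2)\right],\qquad a_1=\frac12\left(n-\frac54\right).$$
   Context: For $\mathbf a,\mathbf b\in\mathbb C^n$, $\mathbf a\cdot\mathbf b=\sum_{j=1}^n a_j\overline{b_j}$, $|\mathbf a|=\sqrt{\mathbf a\cdot\mathbf a}$. $\mathbf S^n=\{\mathbf x\in\mathbb C^n:|\mathbf x|=1\}$. $g_a:\mathbb C\to\mathbb C$ is the entire function $g_a(z)=\sum_{\ell=0}^\infty\frac{\sqrt{a\ell+1}}{\ell!}z^\ell$ and $g_a^{(s)}$ is its $s$-th derivative. For $n\ge2$, $\mathbf K^\hbar_{n,-1}(\mathbf x,\mathbf z)=\sum_{\ell=0}^\infty\frac{c_{\ell,-1}}{\ell!}\left(\frac{\mathbf x\cdot\mathbf z}{\hbar}\right)^\ell$ with $c_{\ell,-1}>0$, $(c_{\ell,-1})^2=\frac{(n)_\ell}{(n-1)_\ell}$, $(b)_\ell=b(b+1)\cdots(b+\ell-1)$; thus $\mathbf K^\hbar_{n,-1}(\mathbf x,\mathbf z)=g_{1/(n-1)}(\mathbf x\cdot\mathbf z/\hbar)$. Square roots use the principal branch. *)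

theory Defs
  imports "HOL-Complex_Analysis.Complex_Analysis" "HOL-Library.Landau_Symbols"
begin

text \<open>Vectors of \<open>\<complex>\<^sup>n\<close> are elements of \<open>complex ^ 'n\<close> with \<open>n = CARD('n)\<close>. The library inner product
  on this type is the real one, hence the explicit Hermitian product, linear in the first
  argument.\<close>

definition cdot :: "complex ^ 'n \<Rightarrow> complex ^ 'n \<Rightarrow> complex" where
  "cdot x y = (\<Sum>j\<in>UNIV. x $ j * cnj (y $ j))"

text \<open>The library norm is the norm of the Hermitian product, so \<open>sphere 0 1\<close> is the unit sphere
  of \<open>\<complex>\<^sup>n\<close>.\<close>

lemma of_real_norm_eq_csqrt_cdot: "complex_of_real (norm x) = csqrt (cdot x x)"
proof -
  have "cdot x x = of_real ((norm x)\<^sup>2)"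
    by (simp add: cdot_def norm_vec_def L2_set_def sum_nonneg complex_norm_square
        flip: of_real_power)
  then show ?thesis
    by simp
qed

definition W :: "real \<Rightarrow> complex ^ 'n \<Rightarrow> (complex ^ 'n) set" where
  "W C z = {x \<in> sphere 0 1. C * (Re (cdot x z) / norm z) \<ge> 1}"

definition V :: "real \<Rightarrow> complex ^ 'n \<Rightarrow> (complex ^ 'n) set" where
  "V C z = sphere 0 1 - W C z"

definition g :: "real \<Rightarrow> complex \<Rightarrow> complex" where
  "g a z = (\<Sum>l. of_real (sqrt (a * real l + 1)) / fact l * z ^ l)"

text \<open>The filter of \<open>Re z\<close> tending to \<open>+\<infinity>\<close> within the sector \<open>\<bar>Im z\<bar> \<le> C * Re z\<close>.\<close>

definition sector_at_top :: "real \<Rightarrow> complex filter" where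
  "sector_at_top C = inf (filtercomap Re at_top) (principal {z. \<bar>Im z\<bar> \<le> C * Re z})"

definition g_expansion :: "real \<Rightarrow> nat \<Rightarrow> real \<Rightarrow> complex \<Rightarrow> bool" where
  "g_expansion a s C c \<longleftrightarrow>
    (\<exists>E \<in> O[sector_at_top C](\<lambda>z. 1 / z\<^sup>2). \<forall>\<^sub>F z in sector_at_top C.
      (deriv ^^ s) (g a) z = of_real (sqrt a) * csqrt z * exp z * (1 + c / z + E z))"

text \<open>The description is meaningful only where the expansion exists in every sector; the
  coefficient is then unique, since all sectors contain the positive real axis.\<close>

definition a1_coeff :: "real \<Rightarrow> nat \<Rightarrow> complex" where
  "a1_coeff a s = (THE c. \<forall>C>1. g_expansion a s C c)"

text \<open>The positive number whose square is \<open>(n)\<^sub>l / (n - 1)\<^sub>l\<close>, for \<open>n \<ge> 2\<close>.\<close>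

definition c_coeff :: "nat \<Rightarrow> nat \<Rightarrow> real" where
  "c_coeff n l = sqrt (pochhammer (real n) l / pochhammer (real n - 1) l)"

definition K :: "real \<Rightarrow> complex ^ 'n \<Rightarrow> complex ^ 'n \<Rightarrow> complex" where
  "K h x z = (\<Sum>l. of_real (c_coeff CARD('n) l) / fact l * (cdot x z / of_real h) ^ l)"

end

(* The s-th derivative of g_a is sqrt a * F_b with b = 1/a + s and
   F_b(z) = sum_l sqrt (l + b) z^l / l!. Writing sqrt (l + b) = (l + b) / sqrt (l + b) gives
   F_b(z) = z G_{b+1}(z) + b G_b(z) with G_b(z) = sum_l (l + b)^(-1/2) z^l / l!, and
   1 / sqrt u = pi^(-1/2) * integral over R of exp (- u y^2) dy turns G_b into
   pi^(-1/2) * integral of exp (- b y^2) exp (z exp (- y^2)) dy. This is at most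
   exp (max (Re z) 0) / sqrt b, which gives the bound on V; Laplace's method at y = 0 gives
   e^z z^(-1/2) (1 + (3/4 - b) / (2 z) + O(z^(-2))) in sectors inside the right half-plane,
   hence a_{1,s} = b/2 - 1/8. *)
theory Submission
  imports Defs "HOL-Probability.Distributions"
begin

section \<open>Gaussian moments\<close>

text \<open>Gaussian integrals produce only negative powers of u, which is why the square root is
  traded for its reciprocal. The trade costs a factor z, so the first correction to F_b has two
  sources: G_{b+1} contributes (3/4 - (b+1))/2 and the leading term of b G_b contributes b, together
  b/2 - 1/8. The obstacle is that z is complex. The Gaussian moments at z are needed with the
  principal root, and the remainder must be uniform in a sector. Absolute values in Laplace's method
  replace exp(-z t) by exp(-Re z t), so the error comes out in powers of |z| and of 1/Re z
  separately; in a sector the two are comparable. Uniformity in x on W is then inherited, because x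
  -> (x . z)/h maps W into one such sector, with real part at least |z|/(C h).\<close>

lemma has_bochner_integral_norm_le:
  fixes f :: "'a::euclidean_space \<Rightarrow> 'b::{banach, second_countable_topology}"
  assumes "has_bochner_integral M f I" "has_bochner_integral M h J" "\<And>x. norm (f x) \<le> h x"
  shows "norm I \<le> J"
  using Bochner_Integration.integral_norm_bound_integral[of M f h] assms
  by (auto simp: has_bochner_integral_iff)

text \<open>Substituting \<open>sqrt x * y\<close> for y reduces this to x = 1. The value is kept as
  \<open>pochhammer (1 / 2) k\<close>, that is Gamma(k + 1/2)/Gamma(1/2), so that sums of moments
  become binomial series in the complex case.\<close>

lemma gaussian_moment_real:
  assumes "x > 0"
  shows "has_bochner_integral lborel (\<lambda>y::real. exp (- (x * y\<^sup>2)) * y ^ (2 * k))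
           (sqrt pi * pochhammer (1 / 2) k / (x ^ k * sqrt x))"
proof -
  have pos: "sqrt x > 0" using assms by simp
  have xk: "sqrt x ^ (2 * k) = x ^ k"
    using assms by (simp add: power_mult)
  have "has_bochner_integral lborel (\<lambda>y::real. exp (- y\<^sup>2) * y ^ (2 * k))
          (sqrt pi * pochhammer (1 / 2) k)"
    using has_bochner_integral_even_function[OF gaussian_moment_even_pos[where k = k]]
    by (simp add: fact_double)
  from has_bochner_integral_mult_left[OF this, of "1 / x ^ k"]
  have "has_bochner_integral lborel (\<lambda>y::real. exp (- y\<^sup>2) * y ^ (2 * k) * (1 / x ^ k))
          (sqrt pi * pochhammer (1 / 2) k * (1 / x ^ k))"
    by auto
  then have "has_bochner_integral lborel
       (\<lambda>y. exp (- (0 + sqrt x * y)\<^sup>2) * (0 + sqrt x * y) ^ (2 * k) * (1 / x ^ k))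
       ((sqrt pi * pochhammer (1 / 2) k * (1 / x ^ k)) /\<^sub>R \<bar>sqrt x\<bar>)"
    using pos by (subst (asm) lborel_has_bochner_integral_real_affine_iff[where c = "sqrt x" and t = 0]) auto
  moreover have "exp (- (0 + sqrt x * y)\<^sup>2) * (0 + sqrt x * y) ^ (2 * k) * (1 / x ^ k)
      = exp (- (x * y\<^sup>2)) * y ^ (2 * k)" for y
    using assms by (simp add: power_mult_distrib xk)
  moreover have "(sqrt pi * pochhammer (1 / 2) k * (1 / x ^ k)) /\<^sub>R \<bar>sqrt x\<bar>
      = sqrt pi * pochhammer (1 / 2) k / (x ^ k * sqrt x)"
    using assms by (simp add: field_simps)
  ultimately show ?thesis by simp
qed

text \<open>The generalized binomial series for exponent -c: the sign in (-c choose j) cancels the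
  one in (-u)^j.\<close>

lemma pochhammer_series_complex:
  fixes c u :: complex
  assumes "norm u < 1"
  shows "(\<lambda>j. pochhammer c j / fact j * u ^ j) sums ((1 - u) powr (- c))"
proof -
  have "(\<lambda>j. (- c gchoose j) * (- u) ^ j) sums ((1 + - u) powr (- c))"
    by (rule gen_binomial_complex) (use assms in simp)
  moreover have "(- c gchoose j) * (- u) ^ j = pochhammer c j / fact j * u ^ j" for j
    by (simp add: gbinomial_pochhammer power_minus[of u])
  ultimately show ?thesis by simp
qed

text \<open>A nonnegative factor does not change the argument, so the principal branch is respected.
  This fixes the branch in the complex moments and absorbs the factor 1/(n-1) into the root for
  \<open>K\<close>.\<close>

lemma csqrt_of_real_mult:
  assumes "x \<ge> 0"
  shows "csqrt (of_real x * z) = of_real (sqrt x) * csqrt z"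
proof (cases "x = 0 \<or> z = 0")
  case False
  then have "csqrt (of_real x * z) = of_real x powr (1 / 2) * z powr (1 / 2)"
    using assms by (simp add: csqrt_conv_powr powr_times_real_left)
  also have "\<dots> = csqrt (of_real x) * csqrt z"
    using False by (subst (1 2) csqrt_conv_powr) auto
  also have "csqrt (of_real x) = of_real (sqrt x)"
    using assms by simp
  finally show ?thesis .
qed auto

lemma gaussian_moment_complex:
  assumes "Re z > 0"
  shows "has_bochner_integral lborel (\<lambda>y::real. exp (- (z * of_real (y\<^sup>2))) * of_real (y ^ (2 * k)))
           (of_real (sqrt pi * pochhammer (1 / 2) k) / (z ^ k * csqrt z))"
proof -
  \<comment> \<open>Any \<open>x > \<bar>z\<bar>\<^sup>2 / (2 * Re z)\<close> satisfies \<open>\<bar>x - z\<bar> < x\<close>, so that the moment at \<open>z\<close> is a binomial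
    series in \<open>(x - z) / x\<close> built from the real moments at \<open>x\<close>.\<close>
  define x where "x = (cmod z)\<^sup>2 / Re z"
  have z0: "z \<noteq> 0" using assms by auto
  have x: "x > 0" using assms z0 by (simp add: x_def)
  define w where "w = of_real x - z"
  define u where "u = w / of_real x"
  have "(cmod w)\<^sup>2 = x\<^sup>2 - 2 * x * Re z + (cmod z)\<^sup>2"
    by (simp add: w_def cmod_power2) (simp add: power2_eq_square algebra_simps)
  also have "x * Re z = (cmod z)\<^sup>2" using assms by (simp add: x_def)
  then have "x\<^sup>2 - 2 * x * Re z + (cmod z)\<^sup>2 < x\<^sup>2"
    using z0 by (simp add: mult.assoc)
  finally have w: "cmod w < x" using x by (simp add: power2_less_imp_less)
  then have u: "cmod u < 1" using x by (simp add: u_def norm_divide)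
  \<comment> \<open>These are the terms of exp(-x y^2) y^(2k) exp(w y^2), with the last exponential
    expanded; term j is the real moment of index k + j at x.\<close>
  define f where "f = (\<lambda>j y. of_real (exp (- (x * y\<^sup>2)) * y ^ (2 * (k + j))) * (w ^ j / fact j))"
  define M where "M = (\<lambda>j. sqrt pi * pochhammer (1 / 2) (k + j) / (x ^ (k + j) * sqrt x))"
  have f_int: "has_bochner_integral lborel (f j) (of_real (M j) * (w ^ j / fact j))" for j
    unfolding f_def M_def
    by (intro has_bochner_integral_mult_left has_bochner_integral_of_real gaussian_moment_real x)
  have norm_f: "norm (f j y) = exp (- (x * y\<^sup>2)) * y ^ (2 * (k + j)) * (cmod w ^ j / fact j)" for j y
  proof -
    have "0 \<le> y ^ (2 * (k + j))" by (intro zero_le_even_power) simp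
    then show ?thesis
      by (simp add: f_def norm_mult norm_divide norm_power power_even_abs del: distrib_left_numeral)
  qed
  have norm_f_int: "has_bochner_integral lborel (\<lambda>y. norm (f j y)) (M j * (cmod w ^ j / fact j))" for j
    unfolding norm_f M_def
    by (intro has_bochner_integral_mult_left gaussian_moment_real x)
  have M_eq: "M j = M 0 * (pochhammer (1 / 2 + real k) j / x ^ j)" for j
    by (simp add: M_def pochhammer_product' power_add mult_ac)
  have f_sums: "(\<lambda>j. f j y) sums (exp (- (z * of_real (y\<^sup>2))) * of_real (y ^ (2 * k)))" for y
  proof -
    have "(\<lambda>j. of_real (exp (- (x * y\<^sup>2)) * y ^ (2 * k)) * ((w * of_real (y\<^sup>2)) ^ j /\<^sub>R fact j)) sums
            (of_real (exp (- (x * y\<^sup>2)) * y ^ (2 * k)) * exp (w * of_real (y\<^sup>2)))"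
      by (intro sums_mult exp_converges)
    moreover have "of_real (exp (- (x * y\<^sup>2)) * y ^ (2 * k)) * ((w * of_real (y\<^sup>2)) ^ j /\<^sub>R fact j)
        = f j y" for j
    proof -
      have "y ^ (2 * (k + j)) = y ^ (2 * k) * (y\<^sup>2) ^ j"
        by (simp add: power_add flip: power_mult)
      then show ?thesis
        unfolding f_def by (simp only: power_mult_distrib scaleR_conv_of_real)
          (simp add: field_simps)
    qed
    moreover have "of_real (exp (- (x * y\<^sup>2)) * y ^ (2 * k)) * exp (w * of_real (y\<^sup>2))
        = exp (- (z * of_real (y\<^sup>2))) * of_real (y ^ (2 * k))"
      by (simp add: w_def exp_of_real[symmetric] exp_add[symmetric] algebra_simps
            del: exp_of_real flip: mult.assoc)
    ultimately show ?thesis by (simp only:)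
  qed
  \<comment> \<open>Up to the factor \<open>M 0\<close> this is the binomial series with exponent
    -(1/2 + k) at |u| < 1. Its convergence justifies exchanging sum and integral.\<close>
  have summable_norm: "summable (\<lambda>j. M j * (cmod w ^ j / fact j))"
  proof -
    have "summable (\<lambda>j. pochhammer (of_real (1 / 2 + real k)) j / fact j * of_real (cmod u) ^ j :: complex)"
      by (rule sums_summable[OF pochhammer_series_complex]) (use u in simp)
    then have "summable (\<lambda>j. of_real (pochhammer (1 / 2 + real k) j / fact j * cmod u ^ j) :: complex)"
      by (simp only: pochhammer_of_real of_real_mult of_real_divide of_real_power of_real_fact)
    then have "summable (\<lambda>j. pochhammer (1 / 2 + real k) j / fact j * cmod u ^ j)"
      by (subst (asm) summable_of_real_iff)
    from summable_mult[OF this, of "M 0"] show ?thesis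
      using x by (subst M_eq) (simp add: u_def norm_divide power_divide mult_ac)
  qed
  have AE: "AE y in lborel. summable (\<lambda>j. norm (f j y))"
  proof (rule AE_I2)
    fix y
    have "summable (\<lambda>j. (exp (- (x * y\<^sup>2)) * y ^ (2 * k)) * ((cmod w * y\<^sup>2) ^ j /\<^sub>R fact j))"
      by (intro summable_mult summable_exp_generic)
    moreover have "(exp (- (x * y\<^sup>2)) * y ^ (2 * k)) * ((cmod w * y\<^sup>2) ^ j /\<^sub>R fact j) = norm (f j y)" for j
    proof -
      have "y ^ (2 * (k + j)) = y ^ (2 * k) * (y\<^sup>2) ^ j"
        by (simp add: power_add flip: power_mult)
      then show ?thesis
        unfolding norm_f by (simp only: power_mult_distrib) (simp add: field_simps)
    qed
    ultimately show "summable (\<lambda>j. norm (f j y))" by (simp only:)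
  qed
  have fi: "integrable lborel (f j)" for j
    using f_int by (simp add: has_bochner_integral_iff)
  have sm: "summable (\<lambda>j. \<integral>y. norm (f j y) \<partial>lborel)"
    using summable_norm by (simp only: has_bochner_integral_integral_eq[OF norm_f_int])
  have suminf_f: "(\<lambda>y. \<Sum>j. f j y) = (\<lambda>y. exp (- (z * of_real (y\<^sup>2))) * of_real (y ^ (2 * k)))"
    using f_sums by (simp add: fun_eq_iff sums_unique[symmetric])
  have "integrable lborel (\<lambda>y. exp (- (z * of_real (y\<^sup>2))) * of_real (y ^ (2 * k)))"
    using integrable_suminf[OF fi AE sm] by (simp only: suminf_f)
  moreover have "(\<lambda>j. of_real (M j) * (w ^ j / fact j)) sums
      (\<integral>y. exp (- (z * of_real (y\<^sup>2))) * of_real (y ^ (2 * k)) \<partial>lborel)"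
    using sums_integral[OF fi AE sm] f_int
    by (simp only: suminf_f has_bochner_integral_integral_eq[OF f_int])
  moreover have "(\<lambda>j. of_real (M j) * (w ^ j / fact j)) sums
      (of_real (sqrt pi * pochhammer (1 / 2) k) / (z ^ k * csqrt z))"
  proof -
    have "(\<lambda>j. of_real (M 0) * (pochhammer (of_real (1 / 2 + real k)) j / fact j * u ^ j)) sums
            (of_real (M 0) * (1 - u) powr (- of_real (1 / 2 + real k)))"
      by (intro sums_mult pochhammer_series_complex u)
    moreover have "of_real (M 0) * (pochhammer (of_real (1 / 2 + real k)) j / fact j * u ^ j)
        = of_real (M j) * (w ^ j / fact j)" for j
      by (subst M_eq[of j]) (simp add: pochhammer_of_real[symmetric] u_def power_divide mult_ac)
    moreover have "of_real (M 0) * (1 - u) powr (- of_real (1 / 2 + real k))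
        = of_real (sqrt pi * pochhammer (1 / 2) k) / (z ^ k * csqrt z)"
    proof -
      \<comment> \<open>The binomial sum is (z/x)^(-k-1/2), so the auxiliary point x cancels against
        the factor 1/(x^k sqrt x) in \<open>M 0\<close>.\<close>
      have 1: "1 - u = of_real (inverse x) * z"
        using x by (simp add: u_def w_def field_simps)
      then have nz: "1 - u \<noteq> 0" using x z0 by simp
      have "(1 - u) powr (- of_real (1 / 2 + real k)) = inverse ((1 - u) powr (1 / 2 + of_nat k))"
        using powr_minus[of "1 - u" "1 / 2 + of_nat k"] by simp
      also have "\<dots> = inverse (csqrt (1 - u) * (1 - u) ^ k)"
        using nz by (simp add: powr_add csqrt_conv_powr powr_nat')
      also have "csqrt (1 - u) = of_real (sqrt (inverse x)) * csqrt z"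
        unfolding 1 using x by (intro csqrt_of_real_mult) simp
      finally have 2: "(1 - u) powr (- of_real (1 / 2 + real k))
          = inverse (of_real (sqrt (inverse x)) * csqrt z * (1 - u) ^ k)" .
      show ?thesis
        unfolding 2 unfolding M_def 1
        using x z0 by (simp add: field_simps real_sqrt_divide power_divide)
    qed
    ultimately show ?thesis by simp
  qed
  ultimately show ?thesis
    by (simp add: has_bochner_integral_iff sums_unique2)
qed

section \<open>The series and their integral representation\<close>

definition inv_sqrt_series :: "real \<Rightarrow> complex \<Rightarrow> complex" where
  "inv_sqrt_series b z = (\<Sum>l. of_real (1 / sqrt (real l + b)) / fact l * z ^ l)"

text \<open>The shift \<open>b\<close> stays a parameter because differentiation raises it by 1, so
  one family contains all derivatives of \<open>g a\<close> up to the factor sqrt a.\<close>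

definition sqrt_series :: "real \<Rightarrow> complex \<Rightarrow> complex" where
  "sqrt_series b z = (\<Sum>l. of_real (sqrt (real l + b)) / fact l * z ^ l)"

text \<open>Since exp(-(l+b) y^2) = exp(-b y^2) (exp(-y^2))^l, summing under the integral sign gives
  an exponential series in z exp(-y^2), while integrating term by term gives the coefficients
  1/sqrt(l+b). The one exchange of sum and integral yields both claims.\<close>

lemma
  assumes b: "b > 0"
  shows inv_sqrt_series_sums:
      "(\<lambda>l. of_real (1 / sqrt (real l + b)) / fact l * z ^ l) sums inv_sqrt_series b z" (is ?sums)
    and inv_sqrt_series_integral:
      "has_bochner_integral lborel (\<lambda>y::real. of_real (exp (- (b * y\<^sup>2))) * exp (z * of_real (exp (- y\<^sup>2))))
         (of_real (sqrt pi) * inv_sqrt_series b z)" (is ?int)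
proof -
  define f where "f = (\<lambda>l y. of_real (exp (- ((real l + b) * y\<^sup>2))) * (z ^ l / fact l))"
  have pos: "real l + b > 0" for l using b by simp
  have gauss: "has_bochner_integral lborel (\<lambda>y::real. exp (- ((real l + b) * y\<^sup>2))) (sqrt pi / sqrt (real l + b))" for l
    using gaussian_moment_real[OF pos[of l], of 0] by simp
  have f_int: "has_bochner_integral lborel (f l) (of_real (sqrt pi / sqrt (real l + b)) * (z ^ l / fact l))" for l
    unfolding f_def by (intro has_bochner_integral_mult_left has_bochner_integral_of_real gauss)
  have norm_f: "norm (f l y) = exp (- ((real l + b) * y\<^sup>2)) * (cmod z ^ l / fact l)" for l y
    by (simp add: f_def norm_mult norm_divide norm_power)
  have norm_f_int: "has_bochner_integral lborel (\<lambda>y. norm (f l y)) (sqrt pi / sqrt (real l + b) * (cmod z ^ l / fact l))" for l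
    unfolding norm_f by (intro has_bochner_integral_mult_left gauss)
  have f_eq: "f l y = of_real (exp (- (b * y\<^sup>2))) * ((z * of_real (exp (- y\<^sup>2))) ^ l /\<^sub>R fact l)" for l y
  proof -
    have "exp (- ((real l + b) * y\<^sup>2)) = exp (- (b * y\<^sup>2)) * exp (- y\<^sup>2) ^ l"
      by (simp add: exp_of_nat_mult[symmetric] exp_add[symmetric] algebra_simps)
    then show ?thesis
      by (simp add: f_def power_mult_distrib scaleR_conv_of_real field_simps del: of_real_exp)
  qed
  have f_sums: "(\<lambda>l. f l y) sums (of_real (exp (- (b * y\<^sup>2))) * exp (z * of_real (exp (- y\<^sup>2))))" for y
    unfolding f_eq by (intro sums_mult exp_converges)
  have AE: "AE y in lborel. summable (\<lambda>l. norm (f l y))"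
  proof (rule AE_I2)
    fix y
    show "summable (\<lambda>l. norm (f l y))"
      unfolding f_eq norm_mult by (intro summable_mult summable_norm_exp)
  qed
  have "summable (\<lambda>l. sqrt pi / sqrt (real l + b) * (cmod z ^ l / fact l))"
  proof (rule summable_comparison_test')
    show "summable (\<lambda>l. sqrt pi / sqrt b * (cmod z ^ l /\<^sub>R fact l))"
      by (intro summable_mult summable_exp_generic)
    show "norm (sqrt pi / sqrt (real l + b) * (cmod z ^ l / fact l)) \<le> sqrt pi / sqrt b * (cmod z ^ l /\<^sub>R fact l)" for l
    proof -
      have "sqrt pi / sqrt (real l + b) * (cmod z ^ l / fact l) \<le> sqrt pi / sqrt b * (cmod z ^ l / fact l)"
        using b by (intro mult_right_mono divide_left_mono) auto
      then show ?thesis using b by (simp add: divide_inverse_commute)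
    qed
  qed
  then have sm: "summable (\<lambda>l. \<integral>y. norm (f l y) \<partial>lborel)"
    by (simp only: has_bochner_integral_integral_eq[OF norm_f_int])
  have fi: "integrable lborel (f l)" for l
    using f_int by (simp add: has_bochner_integral_iff)
  have suminf_f: "(\<lambda>y. \<Sum>l. f l y) = (\<lambda>y. of_real (exp (- (b * y\<^sup>2))) * exp (z * of_real (exp (- y\<^sup>2))))"
    using f_sums by (simp add: fun_eq_iff sums_unique[symmetric])
  let ?I = "\<integral>y. of_real (exp (- (b * y\<^sup>2))) * exp (z * of_real (exp (- y\<^sup>2))) \<partial>lborel"
  have i: "integrable lborel (\<lambda>y. of_real (exp (- (b * y\<^sup>2))) * exp (z * of_real (exp (- y\<^sup>2))))"
    using integrable_suminf[OF fi AE sm] by (simp only: suminf_f)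
  have "(\<lambda>l. of_real (sqrt pi / sqrt (real l + b)) * (z ^ l / fact l)) sums ?I"
    using sums_integral[OF fi AE sm] f_int
    by (simp only: suminf_f has_bochner_integral_integral_eq[OF f_int])
  from sums_divide[OF this, of "of_real (sqrt pi)"]
  have s: "(\<lambda>l. of_real (1 / sqrt (real l + b)) / fact l * z ^ l) sums (?I / of_real (sqrt pi))"
    by (simp add: field_simps)
  then show sums: ?sums
    by (simp add: inv_sqrt_series_def sums_iff)
  show ?int
    using i sums_unique2[OF s sums] by (simp add: has_bochner_integral_iff field_simps)
qed

text \<open>The numerator of (l + b)/sqrt(l + b) is split. The part with l vanishes at l = 0, and
  l/l! = 1/(l-1)!, so an index shift extracts the factor z and turns b into b + 1.\<close>

lemma sqrt_series_sums:
  assumes b: "b > 0"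
  shows "(\<lambda>l. of_real (sqrt (real l + b)) / fact l * z ^ l) sums
           (z * inv_sqrt_series (b + 1) z + of_real b * inv_sqrt_series b z)"
proof -
  define t where "t = (\<lambda>l. of_real (real l / sqrt (real l + b)) / fact l * z ^ l)"
  have "(\<lambda>l. z * (of_real (1 / sqrt (real l + (b + 1))) / fact l * z ^ l)) sums (z * inv_sqrt_series (b + 1) z)"
    using b by (intro sums_mult inv_sqrt_series_sums) simp
  moreover have "z * (of_real (1 / sqrt (real l + (b + 1))) / fact l * z ^ l) = t (Suc l)" for l
  proof -
    have "complex_of_real (real (Suc l)) \<noteq> 0" by (simp del: of_nat_Suc)
    then show ?thesis
      by (simp add: t_def add_ac del: of_nat_Suc)
  qed
  ultimately have "t sums (z * inv_sqrt_series (b + 1) z)"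
    using sums_Suc[of t] by (simp add: t_def)
  from sums_add[OF this sums_mult[OF inv_sqrt_series_sums[OF b, of z], of "of_real b"]]
  have "(\<lambda>l. t l + of_real b * (of_real (1 / sqrt (real l + b)) / fact l * z ^ l)) sums
     (z * inv_sqrt_series (b + 1) z + of_real b * inv_sqrt_series b z)" .
  moreover have "t l + of_real b * (of_real (1 / sqrt (real l + b)) / fact l * z ^ l)
      = of_real (sqrt (real l + b)) / fact l * z ^ l" for l
  proof -
    have "real l + b > 0" using b by simp
    then have "real l / sqrt (real l + b) + b * (1 / sqrt (real l + b)) = sqrt (real l + b)"
      by (metis add_divide_distrib mult.right_neutral times_divide_eq_right real_div_sqrt less_imp_le)
    then have "of_real (real l / sqrt (real l + b)) + of_real b * of_real (1 / sqrt (real l + b)) = complex_of_real (sqrt (real l + b))"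
      by (metis of_real_add of_real_mult)
    moreover have "t l + of_real b * (of_real (1 / sqrt (real l + b)) / fact l * z ^ l)
        = (of_real (real l / sqrt (real l + b)) + of_real b * of_real (1 / sqrt (real l + b))) / fact l * z ^ l"
      unfolding t_def by (simp only: add_divide_distrib distrib_right times_divide_eq_right mult.assoc times_divide_eq_left)
    ultimately show ?thesis by simp
  qed
  ultimately show ?thesis by simp
qed

lemma sqrt_series_eq:
  "b > 0 \<Longrightarrow> sqrt_series b z = z * inv_sqrt_series (b + 1) z + of_real b * inv_sqrt_series b z"
  unfolding sqrt_series_def by (rule sums_unique[symmetric, OF sqrt_series_sums])

lemma has_field_derivative_sqrt_series:
  assumes b: "b > 0"
  shows "(sqrt_series b has_field_derivative sqrt_series (b + 1) z) (at z)"
proof -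
  have "((\<lambda>z. \<Sum>l. of_real (sqrt (real l + b)) / fact l * z ^ l) has_field_derivative
     (\<Sum>l. diffs (\<lambda>l. of_real (sqrt (real l + b)) / fact l) l * z ^ l)) (at z)"
    using sqrt_series_sums[OF b] by (intro termdiffs_strong_converges_everywhere) (rule sums_summable)
  moreover have "diffs (\<lambda>l. of_real (sqrt (real l + b)) / fact l :: complex) l
      = of_real (sqrt (real l + (b + 1))) / fact l" for l
  proof -
    have "complex_of_nat (Suc l) \<noteq> 0" by (simp del: of_nat_Suc)
    then show ?thesis
      by (simp add: diffs_def add_ac del: of_nat_Suc)
  qed
  ultimately show ?thesis
    by (simp add: sqrt_series_def[abs_def])
qed

lemma higher_deriv_g:
  assumes a: "a > 0"
  shows "(deriv ^^ s) (g a) = (\<lambda>z. of_real (sqrt a) * sqrt_series (1 / a + real s) z)"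
proof (induction s)
  case 0
  have "sqrt (a * real l + 1) = sqrt a * sqrt (real l + 1 / a)" for l
    using a by (simp add: field_simps flip: real_sqrt_mult)
  then have "(\<lambda>l. of_real (sqrt (a * real l + 1)) / fact l * z ^ l) sums (of_real (sqrt a) * sqrt_series (1 / a) z)" for z
    using sums_mult[OF summable_sums[OF sums_summable[OF sqrt_series_sums[of "1 / a" z]]], of "of_real (sqrt a)"] a
    by (simp add: sqrt_series_def field_simps)
  then show ?case
    by (simp add: g_def fun_eq_iff sums_iff)
next
  case (Suc s)
  have pos: "1 / a + real s > 0" using a by (simp add: add_pos_nonneg)
  have "deriv (\<lambda>z. of_real (sqrt a) * sqrt_series (1 / a + real s) z) z
      = of_real (sqrt a) * sqrt_series (1 / a + real s + 1) z" for z
    by (intro DERIV_imp_deriv DERIV_cmult has_field_derivative_sqrt_series pos)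
  then show ?case
    by (simp add: Suc.IH fun_eq_iff add_ac)
qed

section \<open>Growth bounds on the whole plane\<close>

text \<open>As 0 < exp(-y^2) \<le> 1, the inner exponent has real part at most max(Re z, 0), and
  only the Gaussian weight is left to integrate. Both signs of Re z matter, since on V the real part
  may be negative.\<close>

lemma norm_inv_sqrt_series_le:
  assumes b: "b > 0"
  shows "cmod (inv_sqrt_series b z) \<le> exp (max (Re z) 0) / sqrt b"
proof -
  let ?f = "\<lambda>y::real. of_real (exp (- (b * y\<^sup>2))) * exp (z * of_real (exp (- y\<^sup>2)))"
  note f = inv_sqrt_series_integral[OF b, of z]
  have h: "has_bochner_integral lborel (\<lambda>y::real. exp (- (b * y\<^sup>2)) * exp (max (Re z) 0))
      (sqrt pi / sqrt b * exp (max (Re z) 0))"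
    using gaussian_moment_real[OF b, of 0] by (intro has_bochner_integral_mult_left) simp
  have "Re z * exp (- y\<^sup>2) \<le> max (Re z) 0" for y :: real
    by (cases "Re z \<ge> 0") (auto simp: max_def mult_le_0_iff intro!: mult_left_le)
  then have "norm (?f y) \<le> exp (- (b * y\<^sup>2)) * exp (max (Re z) 0)" for y
    by (simp add: norm_mult)
  from has_bochner_integral_norm_le[OF f h this]
  have "sqrt pi * cmod (inv_sqrt_series b z) \<le> sqrt pi / sqrt b * exp (max (Re z) 0)"
    by (simp add: norm_mult)
  also have "\<dots> = sqrt pi * (exp (max (Re z) 0) / sqrt b)" by simp
  finally show ?thesis by (rule mult_left_le_imp_le) simp
qed

lemma norm_sqrt_series_le:
  assumes b: "b > 0"
  shows "cmod (sqrt_series b z) \<le> (1 / sqrt (b + 1) + sqrt b) * (cmod z + 1) * exp (max (Re z) 0)"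
proof -
  let ?e = "exp (max (Re z) 0)"
  have "cmod (sqrt_series b z) \<le> cmod z * cmod (inv_sqrt_series (b + 1) z) + b * cmod (inv_sqrt_series b z)"
    unfolding sqrt_series_eq[OF b]
    using b by (intro order_trans[OF norm_triangle_ineq]) (simp add: norm_mult)
  also have "\<dots> \<le> cmod z * (?e / sqrt (b + 1)) + b * (?e / sqrt b)"
    using b by (intro add_mono mult_left_mono norm_inv_sqrt_series_le) auto
  also have "b * (?e / sqrt b) = sqrt b * ?e"
    using b by (simp add: field_simps)
  also have "cmod z * (?e / sqrt (b + 1)) + sqrt b * ?e \<le> (1 / sqrt (b + 1) + sqrt b) * (cmod z + 1) * ?e"
  proof -
    have "(1 / sqrt (b + 1) + sqrt b) * (cmod z + 1) * ?e
        = cmod z * (?e / sqrt (b + 1)) + sqrt b * ?e + (?e / sqrt (b + 1) + sqrt b * cmod z * ?e)"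
      by (simp add: distrib_left distrib_right)
    moreover have "0 \<le> ?e / sqrt (b + 1) + sqrt b * cmod z * ?e"
      using b by simp
    ultimately show ?thesis by linarith
  qed
  finally show ?thesis .
qed

section \<open>Laplace's method\<close>

text \<open>Both bounds rest on 1 + t \<le> e^t, which gives e^(-t) \<le> 1/(1+t). The first
  controls Taylor remainders; the second preserves half of the decay rate near the peak.\<close>

lemma exp_minus_remainder:
  fixes t :: real
  assumes "t \<ge> 0"
  shows "exp (- t) - (1 - t) \<in> {0..t\<^sup>2}" and "t \<le> 1 \<Longrightarrow> t / 2 \<le> 1 - exp (- t)"
proof -
  have "exp (- t) \<le> 1 / (1 + t)"
    using exp_ge_add_one_self[of t] assms by (simp add: exp_minus field_simps)
  then have 1: "1 - exp (- t) \<ge> t / (1 + t)"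
    using assms by (simp add: field_simps)
  have "t - t\<^sup>2 \<le> t / (1 + t)"
    using assms by (simp add: field_simps power2_eq_square)
  with 1 have "exp (- t) - (1 - t) \<le> t\<^sup>2" by simp
  then show "exp (- t) - (1 - t) \<in> {0..t\<^sup>2}"
    using exp_ge_add_one_self[of "- t"] by simp
  show "t / 2 \<le> 1 - exp (- t)" if "t \<le> 1"
  proof -
    have "t / 2 \<le> t / (1 + t)"
      using assms that by (intro divide_left_mono) auto
    also note 1
    finally show ?thesis .
  qed
qed

text \<open>Here t stands for y^2, of effective size 1/z, so the corrections b t and z t^2/2 have
  the same order. Each error term |z|^i t^(i+2) integrates, in a sector, to order |z|^(-5/2), which
  is |z|^(-2) relative to the leading |z|^(-1/2). The factor b^2 + b + 2 majorizes all coefficients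
  that occur: b^2, b + 2 and 1 for t \<le> 1, and 1 + b and 1 for t \<ge> 1.\<close>

lemma laplace_integrand_approx:
  fixes z :: complex and b t :: real
  assumes b: "b \<ge> 0" and z: "Re z \<ge> 0" and t: "t \<ge> 0"
  shows "cmod (of_real (exp (- (b * t))) * exp (- (z * of_real (1 - exp (- t))))
             - exp (- (z * of_real t)) * (1 - of_real (b * t) + z * of_real (t\<^sup>2) / 2))
    \<le> (b\<^sup>2 + b + 2) * (exp (- (Re z / 2 * t)) * (t ^ 2 + cmod z * t ^ 3 + (cmod z)\<^sup>2 * t ^ 4))
       + exp (- (b * t)) * exp (- (Re z / 2))"
    (is "cmod (?A - ?B) \<le> ?P + ?Q")
proof (cases "t \<le> 1")
  case True
  \<comment> \<open>The exponent is -z t + z q with 0 \<le> q \<le> t^2. The three remainders belong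
    to exp(z q), to the weight exp(-b t), and to replacing q by t^2/2.\<close>
  define q where "q = exp (- t) - (1 - t)"
  define e where "e = exp (- (b * t))"
  define r1 where "r1 = exp (z * of_real q) - (1 + z * of_real q)"
  define r2 where "r2 = e - (1 - b * t)"
  define r3 where "r3 = q - t\<^sup>2 / 2"
  have q: "q \<ge> 0" "q \<le> t\<^sup>2" and tq: "t / 2 \<le> t - q"
    using exp_minus_remainder[OF t] True by (auto simp: q_def)
  have e: "0 \<le> e" "e \<le> 1" "1 - e \<le> b * t"
    using b t exp_ge_add_one_self[of "- (b * t)"] by (auto simp: e_def)
  have r2: "\<bar>r2\<bar> \<le> b\<^sup>2 * t\<^sup>2"
    using exp_minus_remainder(1)[of "b * t"] b t by (simp add: r2_def e_def power_mult_distrib)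
  have r1: "cmod r1 \<le> exp (Re z * q) * ((cmod z)\<^sup>2 * t ^ 4)"
  proof -
    have "cmod r1 \<le> exp (Re z * q) * (cmod z * q)\<^sup>2"
      using Taylor_exp[of "z * of_real q" 1] z q by (simp add: r1_def norm_mult numeral_2_eq_2)
    also have "\<dots> \<le> exp (Re z * q) * (cmod z * t\<^sup>2)\<^sup>2"
      using q by (intro mult_left_mono power_mono) auto
    finally show ?thesis by (simp add: power_mult_distrib)
  qed
  have r3: "\<bar>r3\<bar> \<le> 2 * t ^ 3"
  proof -
    have "\<bar>r3\<bar> \<le> exp t * t ^ 3 / 2"
      using Taylor_exp_field[of "- t" 2] t
      by (simp add: r3_def q_def numeral_2_eq_2 numeral_3_eq_3 algebra_simps)
    also have "\<dots> \<le> 4 * t ^ 3 / 2"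
    proof -
      have "exp t \<le> exp 1" using True by simp
      also have "\<dots> \<le> 4" using exp_le by simp
      finally show ?thesis using t by (intro divide_right_mono mult_right_mono) auto
    qed
    finally show ?thesis by simp
  qed
  have A: "?A = exp (- (z * of_real t)) * (of_real e * exp (z * of_real q))"
    by (simp add: e_def q_def exp_add[symmetric] algebra_simps flip: of_real_exp)
  have D: "?A - ?B = exp (- (z * of_real t)) *
       (of_real e * r1 + of_real r2 + of_real (e - 1) * z * of_real q + z * of_real r3)"
    unfolding A by (simp add: r1_def r2_def r3_def algebra_simps)
  have ineq: "cmod (of_real e * r1 + of_real r2 + of_real (e - 1) * z * of_real q + z * of_real r3)
      \<le> exp (Re z * q) * ((cmod z)\<^sup>2 * t ^ 4) + b\<^sup>2 * t\<^sup>2 + b * t * cmod z * t\<^sup>2 + cmod z * (2 * t ^ 3)"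
  proof (intro norm_triangle_le add_mono)
    show "cmod (of_real e * r1) \<le> exp (Re z * q) * ((cmod z)\<^sup>2 * t ^ 4)"
    proof -
      have "e * cmod r1 \<le> 1 * cmod r1" using e by (intro mult_right_mono) auto
      with r1 e show ?thesis by (simp add: norm_mult)
    qed
    show "cmod (of_real r2) \<le> b\<^sup>2 * t\<^sup>2" using r2 by simp
    show "cmod (of_real (e - 1) * z * of_real q) \<le> b * t * cmod z * t\<^sup>2"
      unfolding norm_mult norm_of_real using e q b t by (intro mult_mono) auto
    show "cmod (z * of_real r3) \<le> cmod z * (2 * t ^ 3)"
      unfolding norm_mult using r3 by (intro mult_left_mono) auto
  qed
  \<comment> \<open>The growth of the remainder of exp(z q) is absorbed by half of the decay of
    exp(-z t), because t - q \<ge> t/2.\<close>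
  have E1: "exp (- (Re z * t)) * exp (Re z * q) \<le> exp (- (Re z / 2 * t))"
    using mult_left_mono[OF tq z] by (simp add: exp_add[symmetric] algebra_simps)
  have E2: "exp (- (Re z * t)) \<le> exp (- (Re z / 2 * t))"
    using z t by simp
  have "cmod (?A - ?B) = exp (- (Re z * t)) *
     cmod (of_real e * r1 + of_real r2 + of_real (e - 1) * z * of_real q + z * of_real r3)"
    unfolding D norm_mult by simp
  also have "\<dots> \<le> exp (- (Re z * t)) *
      (exp (Re z * q) * ((cmod z)\<^sup>2 * t ^ 4) + b\<^sup>2 * t\<^sup>2 + b * t * cmod z * t\<^sup>2 + cmod z * (2 * t ^ 3))"
    by (intro mult_left_mono ineq) simp
  also have "\<dots> = (exp (- (Re z * t)) * exp (Re z * q)) * ((cmod z)\<^sup>2 * t ^ 4)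
      + exp (- (Re z * t)) * (b\<^sup>2 * t\<^sup>2 + b * (cmod z * t ^ 3) + 2 * (cmod z * t ^ 3))"
    by (simp add: algebra_simps power3_eq_cube power2_eq_square)
  also have "\<dots> \<le> exp (- (Re z / 2 * t)) * ((cmod z)\<^sup>2 * t ^ 4)
      + exp (- (Re z / 2 * t)) * (b\<^sup>2 * t\<^sup>2 + b * (cmod z * t ^ 3) + 2 * (cmod z * t ^ 3))"
    using b t by (intro add_mono mult_right_mono E1 E2) auto
  also have "\<dots> = exp (- (Re z / 2 * t)) * (b\<^sup>2 * t\<^sup>2 + (b + 2) * (cmod z * t ^ 3) + 1 * ((cmod z)\<^sup>2 * t ^ 4))"
    by (simp add: algebra_simps)
  also have "\<dots> \<le> exp (- (Re z / 2 * t)) * ((b\<^sup>2 + b + 2) * t\<^sup>2 + (b\<^sup>2 + b + 2) * (cmod z * t ^ 3)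
      + (b\<^sup>2 + b + 2) * ((cmod z)\<^sup>2 * t ^ 4))"
    using b t by (intro mult_left_mono add_mono mult_right_mono) auto
  also have "\<dots> = ?P" by (simp add: algebra_simps)
  also have "\<dots> \<le> ?P + ?Q" by simp
  finally show ?thesis .
next
  case False
  \<comment> \<open>Away from the peak nothing is compared: the two terms are bounded separately,
    the first being exponentially small because 1 - exp(-t) \<ge> 1/2.\<close>
  then have t1: "t \<ge> 1" by simp
  have tt: "1 \<le> t\<^sup>2" "t \<le> t\<^sup>2" "t\<^sup>2 \<le> t ^ 3"
    using t1 power_increasing[of 0 2 t] power_increasing[of 1 2 t] power_increasing[of 2 3 t] by auto
  have "exp (- t) \<le> exp (- 1)" using t1 by simp
  then have "1 - exp (- t) \<ge> 1 / 2"
    using exp_minus_remainder(2)[of 1] by linarith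
  from mult_left_mono[OF this z] have "cmod ?A \<le> ?Q"
    unfolding norm_mult by (intro mult_mono) auto
  moreover have "cmod ?B \<le> ?P"
  proof -
    have "cmod (1 - of_real (b * t) + z * of_real (t\<^sup>2) / 2) \<le> 1 + b * t + cmod z * t\<^sup>2 / 2"
      using b t by (intro norm_triangle_le norm_triangle_le_diff add_mono)
        (auto simp: norm_mult norm_divide norm_power)
    also have "\<dots> \<le> t\<^sup>2 + b * t\<^sup>2 + cmod z * t ^ 3"
    proof -
      have "cmod z * t\<^sup>2 \<le> cmod z * t ^ 3" using tt by (intro mult_left_mono) auto
      moreover have "b * t \<le> b * t\<^sup>2" using tt b by (intro mult_left_mono) auto
      moreover have "0 \<le> cmod z * t\<^sup>2" by simp
      ultimately show ?thesis using tt by linarith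
    qed
    also have "\<dots> = (1 + b) * t\<^sup>2 + 1 * (cmod z * t ^ 3) + 0 * ((cmod z)\<^sup>2 * t ^ 4)"
      by (simp add: algebra_simps)
    also have "\<dots> \<le> (b\<^sup>2 + b + 2) * t\<^sup>2 + (b\<^sup>2 + b + 2) * (cmod z * t ^ 3) + (b\<^sup>2 + b + 2) * ((cmod z)\<^sup>2 * t ^ 4)"
      by (rule add_mono[OF add_mono]; rule mult_right_mono) (use b t in auto)
    finally have 1: "cmod (1 - of_real (b * t) + z * of_real (t\<^sup>2) / 2)
       \<le> (b\<^sup>2 + b + 2) * (t ^ 2 + cmod z * t ^ 3 + (cmod z)\<^sup>2 * t ^ 4)"
      by (simp add: algebra_simps)
    have "cmod ?B \<le> exp (- (Re z / 2 * t)) * ((b\<^sup>2 + b + 2) * (t ^ 2 + cmod z * t ^ 3 + (cmod z)\<^sup>2 * t ^ 4))"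
      unfolding norm_mult using z t by (intro mult_mono 1) auto
    then show ?thesis by (simp add: mult_ac)
  qed
  ultimately show ?thesis
    using norm_triangle_ineq4[of ?A ?B] by linarith
qed

text \<open>The pointwise estimate is integrated at t = y^2. The coefficient (3/4 - b)/2 collects
  -b/(2z) from the second moment and (z/2) * 3/(4 z^2) from the fourth; 3/4, 15/8 and 105/16 are the
  values of \<open>pochhammer (1 / 2)\<close> at 2, 3 and 4.\<close>

lemma inv_sqrt_series_diff_bound:
  assumes b: "b > 0" and z: "Re z > 0"
  shows "cmod (of_real (sqrt pi) * (exp (- z) * inv_sqrt_series b z)
              - of_real (sqrt pi) / csqrt z * (1 + of_real ((3 / 4 - b) / 2) / z))
    \<le> (b\<^sup>2 + b + 2) * sqrt pi *
        (3 / (4 * ((Re z / 2)\<^sup>2 * sqrt (Re z / 2)))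
         + cmod z * (15 / (8 * ((Re z / 2) ^ 3 * sqrt (Re z / 2))))
         + (cmod z)\<^sup>2 * (105 / (16 * ((Re z / 2) ^ 4 * sqrt (Re z / 2)))))
       + sqrt pi / sqrt b * exp (- (Re z / 2))" (is "cmod (?L - ?R) \<le> ?J")
proof -
  have z0: "z \<noteq> 0" using z by auto
  have z2: "Re z / 2 > 0" using z by simp
  have poch: "pochhammer (1 / 2 :: real) 2 = 3 / 4" "pochhammer (1 / 2 :: real) 3 = 15 / 8"
    "pochhammer (1 / 2 :: real) 4 = 105 / 16"
    by (simp_all add: eval_nat_numeral pochhammer_Suc)
  let ?e = "\<lambda>k y. exp (- (z * of_real (y\<^sup>2))) * of_real (y ^ (2 * k)) :: complex"
  let ?m = "\<lambda>k y. exp (- (Re z / 2 * y\<^sup>2)) * y ^ (2 * k) :: real"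
  let ?A = "\<lambda>y::real. of_real (exp (- (b * y\<^sup>2))) * exp (- (z * of_real (1 - exp (- y\<^sup>2))))"
  let ?B = "\<lambda>y::real. exp (- (z * of_real (y\<^sup>2))) * (1 - of_real (b * y\<^sup>2) + z * of_real ((y\<^sup>2)\<^sup>2) / 2)"
  have A: "has_bochner_integral lborel ?A ?L"
  proof -
    have "has_bochner_integral lborel
       (\<lambda>y::real. exp (- z) * (of_real (exp (- (b * y\<^sup>2))) * exp (z * of_real (exp (- y\<^sup>2)))))
       (exp (- z) * (of_real (sqrt pi) * inv_sqrt_series b z))"
      by (intro has_bochner_integral_mult_right inv_sqrt_series_integral b)
    moreover have "exp (- z) * (of_real (exp (- (b * y\<^sup>2))) * exp (z * of_real (exp (- y\<^sup>2)))) = ?A y" for y :: real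
    proof -
      have "exp (- (z * of_real (1 - exp (- y\<^sup>2)))) = exp (- z) * exp (z * of_real (exp (- y\<^sup>2)))"
        unfolding exp_add[symmetric] by (rule arg_cong[of _ _ exp]) (simp add: algebra_simps)
      then show ?thesis by simp
    qed
    ultimately show ?thesis by (simp add: mult_ac)
  qed
  have B: "has_bochner_integral lborel ?B ?R"
  proof -
    have "has_bochner_integral lborel (\<lambda>y. ?e 0 y - of_real b * ?e 1 y + z / 2 * ?e 2 y)
       (of_real (sqrt pi * pochhammer (1 / 2) 0) / (z ^ 0 * csqrt z)
        - of_real b * (of_real (sqrt pi * pochhammer (1 / 2) 1) / (z ^ 1 * csqrt z))
        + z / 2 * (of_real (sqrt pi * pochhammer (1 / 2) 2) / (z ^ 2 * csqrt z)))"
      by (intro has_bochner_integral_add has_bochner_integral_diff has_bochner_integral_mult_right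
          gaussian_moment_complex z)
    moreover have "?e 0 y - of_real b * ?e 1 y + z / 2 * ?e 2 y = ?B y" for y
      by (simp add: algebra_simps power2_eq_square power4_eq_xxxx)
    moreover have "of_real (sqrt pi * pochhammer (1 / 2) 0) / (z ^ 0 * csqrt z)
        - of_real b * (of_real (sqrt pi * pochhammer (1 / 2) 1) / (z ^ 1 * csqrt z))
        + z / 2 * (of_real (sqrt pi * pochhammer (1 / 2) 2) / (z ^ 2 * csqrt z)) = ?R"
      unfolding poch using z0 by (simp add: field_simps power2_eq_square)
    ultimately show ?thesis by (simp only:)
  qed
  have J: "has_bochner_integral lborel
     (\<lambda>y. (b\<^sup>2 + b + 2) * (?m 2 y + cmod z * ?m 3 y + (cmod z)\<^sup>2 * ?m 4 y)
         + exp (- (b * y\<^sup>2)) * exp (- (Re z / 2))) ?J"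
  proof -
    have "has_bochner_integral lborel
     (\<lambda>y. (b\<^sup>2 + b + 2) * (?m 2 y + cmod z * ?m 3 y + (cmod z)\<^sup>2 * ?m 4 y)
         + (exp (- (b * y\<^sup>2)) * y ^ (2 * 0)) * exp (- (Re z / 2)))
     ((b\<^sup>2 + b + 2) * (sqrt pi * pochhammer (1 / 2) 2 / ((Re z / 2) ^ 2 * sqrt (Re z / 2))
        + cmod z * (sqrt pi * pochhammer (1 / 2) 3 / ((Re z / 2) ^ 3 * sqrt (Re z / 2)))
        + (cmod z)\<^sup>2 * (sqrt pi * pochhammer (1 / 2) 4 / ((Re z / 2) ^ 4 * sqrt (Re z / 2))))
      + (sqrt pi * pochhammer (1 / 2) 0 / (b ^ 0 * sqrt b)) * exp (- (Re z / 2)))"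
      by (intro has_bochner_integral_add has_bochner_integral_mult_right has_bochner_integral_mult_left
          gaussian_moment_real z2 b)
    moreover have "(sqrt pi * pochhammer (1 / 2) 2 / ((Re z / 2) ^ 2 * sqrt (Re z / 2))
        + cmod z * (sqrt pi * pochhammer (1 / 2) 3 / ((Re z / 2) ^ 3 * sqrt (Re z / 2)))
        + (cmod z)\<^sup>2 * (sqrt pi * pochhammer (1 / 2) 4 / ((Re z / 2) ^ 4 * sqrt (Re z / 2))))
      = sqrt pi * (3 / (4 * ((Re z / 2)\<^sup>2 * sqrt (Re z / 2)))
         + cmod z * (15 / (8 * ((Re z / 2) ^ 3 * sqrt (Re z / 2))))
         + (cmod z)\<^sup>2 * (105 / (16 * ((Re z / 2) ^ 4 * sqrt (Re z / 2)))))"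
      by (simp only: poch distrib_left times_divide_eq_left times_divide_eq_right divide_divide_eq_left mult_ac)
    ultimately show ?thesis by (simp only: mult.assoc) simp
  qed
  have "cmod (?A y - ?B y) \<le> (b\<^sup>2 + b + 2) * (?m 2 y + cmod z * ?m 3 y + (cmod z)\<^sup>2 * ?m 4 y)
         + exp (- (b * y\<^sup>2)) * exp (- (Re z / 2))" for y
    using laplace_integrand_approx[of b z "y\<^sup>2"] b z
    by (simp add: distrib_left mult_ac flip: power_mult)
  from has_bochner_integral_norm_le[OF has_bochner_integral_diff[OF A B] J this]
  show ?thesis .
qed

text \<open>After multiplication by \<open>csqrt z\<close>, the sector condition bounds |z|/Re z by
  L, so every error term becomes a constant times (Re z)^(-2), hence times |z|^(-2).\<close>

lemma inv_sqrt_series_asymptotics: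
  assumes b: "b > 0"
  shows "\<exists>M. \<forall>z. Re z \<ge> 1 \<longrightarrow> cmod z \<le> L * Re z \<longrightarrow>
    cmod (csqrt z * exp (- z) * inv_sqrt_series b z - (1 + of_real ((3 / 4 - b) / 2) / z)) \<le> M / (cmod z)\<^sup>2"
proof (intro exI allI impI)
  fix z :: complex
  assume z: "Re z \<ge> 1" "cmod z \<le> L * Re z"
  define x where "x = Re z"
  define r where "r = cmod z"
  define q where "q = sqrt (x / 2)"
  have z0: "z \<noteq> 0" using z by auto
  have x: "1 \<le> x" "x \<le> r" "r \<le> L * x"
    using z complex_Re_le_cmod[of z] by (auto simp: x_def r_def)
  have "x \<le> L * x" using x by linarith
  then have L: "L \<ge> 1" using x by simp
  have q: "q > 0" using x by (simp add: q_def)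
  let ?T = "csqrt z * exp (- z) * inv_sqrt_series b z - (1 + of_real ((3 / 4 - b) / 2) / z)"
  let ?D = "of_real (sqrt pi) * (exp (- z) * inv_sqrt_series b z)
              - of_real (sqrt pi) / csqrt z * (1 + of_real ((3 / 4 - b) / 2) / z)"
  have "csqrt z * ?D = of_real (sqrt pi) * ?T"
    using z0 by (simp add: algebra_simps)
  then have "cmod (csqrt z) * cmod ?D = sqrt pi * cmod ?T"
    by (metis norm_mult norm_of_real abs_of_nonneg real_sqrt_ge_zero pi_ge_zero)
  then have T: "cmod ?T = sqrt r * cmod ?D / sqrt pi"
    by (simp add: norm_csqrt r_def)
  have "cmod ?D \<le> (b\<^sup>2 + b + 2) * sqrt pi *
        (3 / (4 * ((x / 2)\<^sup>2 * q)) + r * (15 / (8 * ((x / 2) ^ 3 * q))) + r\<^sup>2 * (105 / (16 * ((x / 2) ^ 4 * q))))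
       + sqrt pi / sqrt b * exp (- (x / 2))"
    using inv_sqrt_series_diff_bound[OF b, of z] z by (simp add: x_def r_def q_def)
  also have "\<dots> = sqrt pi * ((b\<^sup>2 + b + 2) * (3 + 15 * (r / x) + 105 * (r / x)\<^sup>2) / (x\<^sup>2 * q)
       + exp (- (x / 2)) / sqrt b)"
    using x q by (simp add: field_simps eval_nat_numeral)
  also have "\<dots> \<le> sqrt pi * ((b\<^sup>2 + b + 2) * (3 + 15 * L + 105 * L\<^sup>2) / (x\<^sup>2 * q)
       + exp (- (x / 2)) / sqrt b)"
  proof -
    have "r / x \<le> L" using x by (simp add: field_simps)
    moreover have "0 \<le> r / x" using x by simp
    ultimately show ?thesis
      using b q by (intro mult_left_mono add_mono divide_right_mono power_mono) auto
  qed
  finally have D: "cmod ?D / sqrt pi \<le> (b\<^sup>2 + b + 2) * (3 + 15 * L + 105 * L\<^sup>2) / (x\<^sup>2 * q)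
       + exp (- (x / 2)) / sqrt b"
    by (simp add: field_simps)
  have rq: "sqrt r / q \<le> sqrt (2 * L)"
    using x q by (simp add: q_def flip: real_sqrt_divide) (simp add: field_simps)
  have ex: "sqrt r * exp (- (x / 2)) \<le> 216 * L / x\<^sup>2"
  proof -
    \<comment> \<open>A cubic lower bound for exp(x/2) is what is needed: sqrt r \<le> L x uses up
      one power of x and x^(-2) must remain. The constant 216 is 6^3.\<close>
    have "(x / 6) ^ 3 \<le> exp (x / 6) ^ 3"
      using exp_ge_add_one_self[of "x / 6"] x by (intro power_mono) linarith+
    also have "\<dots> = exp (x / 2)" by (simp flip: exp_of_nat_mult)
    finally have e: "exp (- (x / 2)) \<le> 216 / x ^ 3"
      using x by (simp add: exp_minus field_simps power_divide)
    have "sqrt r \<le> r"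
      using x by (intro real_le_lsqrt) (auto simp: power2_eq_square)
    then have "sqrt r \<le> L * x" using x by simp
    then have "sqrt r * exp (- (x / 2)) \<le> (L * x) * (216 / x ^ 3)"
      using e x L by (intro mult_mono) auto
    then show ?thesis using x by (simp add: field_simps eval_nat_numeral)
  qed
  have xr: "1 / x\<^sup>2 \<le> L\<^sup>2 / r\<^sup>2"
  proof -
    have "r\<^sup>2 \<le> (L * x)\<^sup>2" using x by (intro power_mono) auto
    then show ?thesis using x by (simp add: field_simps power_mult_distrib)
  qed
  let ?B = "(b\<^sup>2 + b + 2) * (3 + 15 * L + 105 * L\<^sup>2)"
  have "cmod ?T = sqrt r * (cmod ?D / sqrt pi)" unfolding T by simp
  also have "\<dots> \<le> sqrt r * (?B / (x\<^sup>2 * q) + exp (- (x / 2)) / sqrt b)"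
    using D x by (intro mult_left_mono) auto
  also have "\<dots> = ?B / x\<^sup>2 * (sqrt r / q) + sqrt r * exp (- (x / 2)) / sqrt b"
    using q by (simp add: field_simps)
  also have "\<dots> \<le> ?B / x\<^sup>2 * sqrt (2 * L) + 216 * L / x\<^sup>2 / sqrt b"
    using b L by (intro add_mono mult_left_mono divide_right_mono rq ex) auto
  also have "\<dots> = (?B * sqrt (2 * L) + 216 * L / sqrt b) * (1 / x\<^sup>2)"
    by (simp add: add_divide_distrib mult_ac)
  also have "\<dots> \<le> (?B * sqrt (2 * L) + 216 * L / sqrt b) * (L\<^sup>2 / r\<^sup>2)"
    using b L by (intro mult_left_mono xr) auto
  finally show "cmod ?T \<le> (?B * sqrt (2 * L) + 216 * L / sqrt b) * L\<^sup>2 / (cmod z)\<^sup>2"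
    by (simp add: r_def)
qed

text \<open>Division by \<open>csqrt z * exp z\<close> turns z G_{b+1} into its normalized form and
  b G_b into b/z times its own. The 1/z coefficients of both are merged; the product of b/z with the
  correction of G_b is of second order and joins the error.\<close>

lemma sqrt_series_asymptotics:
  assumes b: "b > 0"
  shows "\<exists>M. \<forall>z. Re z \<ge> 1 \<longrightarrow> cmod z \<le> L * Re z \<longrightarrow>
    cmod (sqrt_series b z / (csqrt z * exp z) - (1 + of_real (b / 2 - 1 / 8) / z)) \<le> M / (cmod z)\<^sup>2"
proof -
  define P where "P = (\<lambda>b z. csqrt z * exp (- z) * inv_sqrt_series b z)"
  define c where "c = (\<lambda>b::real. (3 / 4 - b) / 2)"
  define T where "T = (\<lambda>b z. P b z - (1 + of_real (c b) / z))"
  obtain M0 where M0: "\<And>z. Re z \<ge> 1 \<Longrightarrow> cmod z \<le> L * Re z \<Longrightarrow> cmod (T b z) \<le> M0 / (cmod z)\<^sup>2"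
    using inv_sqrt_series_asymptotics[OF b, of L] unfolding T_def P_def c_def by blast
  have b1: "b + 1 > 0" using b by simp
  obtain M1 where M1: "\<And>z. Re z \<ge> 1 \<Longrightarrow> cmod z \<le> L * Re z \<Longrightarrow> cmod (T (b + 1) z) \<le> M1 / (cmod z)\<^sup>2"
    using inv_sqrt_series_asymptotics[OF b1, of L] unfolding T_def P_def c_def by blast
  show ?thesis
  proof (intro exI allI impI)
    fix z :: complex
    assume z: "Re z \<ge> 1" "cmod z \<le> L * Re z"
    have z0: "z \<noteq> 0" using z by auto
    have r: "cmod z \<ge> 1" using z complex_Re_le_cmod[of z] by linarith
    have sq: "csqrt z * csqrt z = z"
      using power2_csqrt[of z] by (simp add: power2_eq_square)
    have eq: "sqrt_series b z / (csqrt z * exp z) = P (b + 1) z + of_real b / z * P b z"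
    proof -
      have "1 / csqrt z = csqrt z / z" using z0 by (simp add: field_simps sq)
      then have "sqrt_series b z / (csqrt z * exp z) = sqrt_series b z * (csqrt z / z) * exp (- z)"
        by (simp add: exp_minus divide_inverse mult_ac)
      then show ?thesis
        using z0 by (simp add: sqrt_series_eq[OF b] P_def field_simps)
    qed
    have "sqrt_series b z / (csqrt z * exp z) - (1 + of_real (b / 2 - 1 / 8) / z)
        = T (b + 1) z + of_real b / z * T b z + of_real (b * c b) / z\<^sup>2"
    proof -
      have key: "of_real (b / 2 - 1 / 8) = complex_of_real (c (b + 1)) + of_real b"
        unfolding of_real_add[symmetric] c_def by (rule arg_cong[of _ _ of_real]) (simp add: field_simps)
      show ?thesis
        unfolding eq key T_def
        by (simp add: algebra_simps add_divide_distrib power2_eq_square)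
    qed
    also have "cmod \<dots> \<le> M1 / (cmod z)\<^sup>2 + b * (M0 / (cmod z)\<^sup>2) + \<bar>b * c b\<bar> / (cmod z)\<^sup>2"
    proof (intro norm_triangle_le add_mono M1 z)
      have "cmod (of_real b / z) \<le> b"
        using b r z0 divide_left_mono[of 1 "cmod z" b] by (simp add: norm_divide)
      then show "cmod (of_real b / z * T b z) \<le> b * (M0 / (cmod z)\<^sup>2)"
        unfolding norm_mult using M0[OF z] b by (intro mult_mono) auto
      show "cmod (of_real (b * c b) / z\<^sup>2) \<le> \<bar>b * c b\<bar> / (cmod z)\<^sup>2"
        unfolding norm_divide norm_of_real norm_power by simp
    qed
    also have "\<dots> = (M1 + b * M0 + \<bar>b * c b\<bar>) / (cmod z)\<^sup>2"
      by (simp add: add_divide_distrib)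
    finally show "cmod (sqrt_series b z / (csqrt z * exp z) - (1 + of_real (b / 2 - 1 / 8) / z))
        \<le> (M1 + b * M0 + \<bar>b * c b\<bar>) / (cmod z)\<^sup>2" .
  qed
qed

section \<open>Expansion in sectors\<close>

lemma eventually_sector_at_top:
  "eventually P (sector_at_top C) \<longleftrightarrow> (\<exists>N. \<forall>z. Re z \<ge> N \<longrightarrow> \<bar>Im z\<bar> \<le> C * Re z \<longrightarrow> P z)"
  unfolding sector_at_top_def eventually_inf_principal eventually_filtercomap_at_top_linorder by auto

lemma g_expansion_holds:
  assumes a: "a > 0"
  shows "g_expansion a s C (of_real ((1 / a + real s) / 2 - 1 / 8))"
proof -
  define b where "b = 1 / a + real s"
  define c where "c = complex_of_real (b / 2 - 1 / 8)"
  have b: "b > 0" using a by (simp add: b_def add_pos_nonneg)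
  \<comment> \<open>Taking E as the exact remainder makes the identity hold at every nonzero z; only
    its size needs proof. The sector gives |z| \<le> |Re z| + |Im z| \<le> (1 + C) Re z, hence the
    aperture 1 + C.\<close>
  define E where "E = (\<lambda>z. sqrt_series b z / (csqrt z * exp z) - (1 + c / z))"
  obtain M where M: "\<And>z. Re z \<ge> 1 \<Longrightarrow> cmod z \<le> (1 + C) * Re z \<Longrightarrow> cmod (E z) \<le> M / (cmod z)\<^sup>2"
    using sqrt_series_asymptotics[OF b, of "1 + C"] unfolding E_def c_def by blast
  have ev: "\<forall>\<^sub>F z in sector_at_top C. Re z \<ge> 1 \<and> \<bar>Im z\<bar> \<le> C * Re z"
    unfolding eventually_sector_at_top by blast
  have "E \<in> O[sector_at_top C](\<lambda>z. 1 / z\<^sup>2)"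
  proof (rule bigoI)
    show "\<forall>\<^sub>F z in sector_at_top C. norm (E z) \<le> M * norm (1 / z\<^sup>2)"
      using ev
    proof eventually_elim
      case (elim z)
      then have "cmod z \<le> (1 + C) * Re z"
        using cmod_le[of z] by (simp add: algebra_simps)
      with M[of z] elim show ?case by (simp add: norm_divide norm_power)
    qed
  qed
  moreover have "\<forall>\<^sub>F z in sector_at_top C. (deriv ^^ s) (g a) z
      = of_real (sqrt a) * csqrt z * exp z * (1 + c / z + E z)"
    using ev
  proof eventually_elim
    case (elim z)
    then have "z \<noteq> 0" by auto
    then show ?case
      by (simp add: higher_deriv_g[OF a] E_def b_def)
  qed
  ultimately show ?thesis
    unfolding g_expansion_def b_def[symmetric] c_def[symmetric] by blast
qed

text \<open>Cancelling the nonzero leading factor leaves (c - c')/z = O(z^(-2)), so |c - c'| |z|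
  would be bounded along the positive real axis.\<close>

lemma g_expansion_unique:
  assumes a: "a > 0" and C: "C \<ge> 0" and c: "g_expansion a s C c" and c': "g_expansion a s C c'"
  shows "c = c'"
proof (rule ccontr)
  assume ne: "c \<noteq> c'"
  obtain E where E: "E \<in> O[sector_at_top C](\<lambda>z. 1 / z\<^sup>2)"
    and eq: "\<forall>\<^sub>F z in sector_at_top C. (deriv ^^ s) (g a) z = of_real (sqrt a) * csqrt z * exp z * (1 + c / z + E z)"
    using c by (auto simp: g_expansion_def)
  obtain E' where E': "E' \<in> O[sector_at_top C](\<lambda>z. 1 / z\<^sup>2)"
    and eq': "\<forall>\<^sub>F z in sector_at_top C. (deriv ^^ s) (g a) z = of_real (sqrt a) * csqrt z * exp z * (1 + c' / z + E' z)"
    using c' by (auto simp: g_expansion_def)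
  obtain k where k: "k > 0" "\<forall>\<^sub>F z in sector_at_top C. norm (E' z - E z) \<le> k * norm (1 / z\<^sup>2)"
    using sum_in_bigo(2)[OF E' E] by (elim landau_o.bigE)
  have ev: "\<forall>\<^sub>F z in sector_at_top C. z \<noteq> 0"
    unfolding eventually_sector_at_top by (rule exI[of _ 1]) auto
  have "\<forall>\<^sub>F z in sector_at_top C. cmod (c - c') * cmod z \<le> k"
    using eq eq' k(2) ev
  proof eventually_elim
    case (elim z)
    then have "of_real (sqrt a) * csqrt z * exp z * (1 + c / z + E z)
        = of_real (sqrt a) * csqrt z * exp z * (1 + c' / z + E' z)" by metis
    then have "1 + c / z + E z = 1 + c' / z + E' z"
      using a elim by simp
    then have "(c - c') / z = E' z - E z" by (simp add: diff_divide_distrib algebra_simps)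
    then have "cmod (c - c') / cmod z \<le> k / (cmod z)\<^sup>2"
      using elim(3) by (metis norm_divide norm_one norm_power times_divide_eq_right mult.right_neutral)
    then show ?case using elim(4) by (simp add: field_simps power2_eq_square)
  qed
  then obtain N where N: "\<And>z. Re z \<ge> N \<Longrightarrow> \<bar>Im z\<bar> \<le> C * Re z \<Longrightarrow> cmod (c - c') * cmod z \<le> k"
    unfolding eventually_sector_at_top by blast
  \<comment> \<open>A real point, inside the sector because C \<ge> 0, beyond the threshold N, and
    large enough to push |c - c'| x past k.\<close>
  define x where "x = max (max N 0) ((k + 1) / cmod (c - c'))"
  have "cmod (c - c') * x \<le> k"
    using N[of "of_real x"] C by (simp add: x_def)
  moreover have "k + 1 \<le> cmod (c - c') * x"
    using ne mult_left_mono[of "(k + 1) / cmod (c - c')" x "cmod (c - c')"] by (simp add: x_def)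
  ultimately show False by simp
qed

lemma a1_coeff_eq:
  assumes "a > 0"
  shows "a1_coeff a s = of_real ((1 / a + real s) / 2 - 1 / 8)"
  unfolding a1_coeff_def
proof (rule the_equality)
  show "\<forall>C>1. g_expansion a s C (of_real ((1 / a + real s) / 2 - 1 / 8))"
    using g_expansion_holds[OF assms] by blast
  show "c = of_real ((1 / a + real s) / 2 - 1 / 8)" if "\<forall>C>1. g_expansion a s C c" for c
    using that g_expansion_unique[OF assms, of 2 s c] g_expansion_holds[OF assms] by simp
qed

section \<open>Transfer to the sphere, uniformly on W and V\<close>

text \<open>Reduces to the real Cauchy-Schwarz inequality for the vectors of moduli.\<close>

lemma norm_cdot_le: "cmod (cdot x y) \<le> norm x * norm y"
proof -
  have "cmod (cdot x y) \<le> (\<Sum>j\<in>UNIV. cmod (x $ j) * cmod (y $ j))"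
    unfolding cdot_def by (rule order_trans[OF norm_sum]) (simp add: norm_mult)
  also have "\<dots> \<le> norm x * norm y"
    unfolding norm_vec_def using L2_set_mult_ineq[of "\<lambda>j. cmod (x $ j)" "\<lambda>j. cmod (y $ j)" UNIV] by simp
  finally show ?thesis .
qed

text \<open>The chain |Im| \<le> |x . z| \<le> |z| \<le> C Re(x . z) shows why the constant defining
  W is also the aperture of the sector.\<close>

lemma cdot_in_W:
  assumes "x \<in> W C z" "z \<noteq> 0" "C > 0"
  shows "norm z / C \<le> Re (cdot x z)" "\<bar>Im (cdot x z)\<bar> \<le> C * Re (cdot x z)"
proof -
  have "norm z \<le> C * Re (cdot x z)"
    using assms by (simp add: W_def field_simps)
  moreover have "cmod (cdot x z) \<le> norm z"
    using norm_cdot_le[of x z] assms by (simp add: W_def)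
  ultimately show "norm z / C \<le> Re (cdot x z)" "\<bar>Im (cdot x z)\<bar> \<le> C * Re (cdot x z)"
    using assms abs_Im_le_cmod[of "cdot x z"] by (auto simp: field_simps)
qed

text \<open>The product with a principal filter encodes uniformity: one threshold for h serves all x
  in S.\<close>

lemma eventually_at_right_0_times_principal:
  assumes "\<And>h x. 0 < h \<Longrightarrow> h < e \<Longrightarrow> x \<in> S \<Longrightarrow> P (h, x)" "e > 0"
  shows "eventually P (at_right (0 :: real) \<times>\<^sub>F principal S)"
  unfolding eventually_prod_filter
  using assms eventually_at_right_real[of 0 e]
  by (intro exI[of _ "\<lambda>h. h \<in> {0<..<e}"] exI[of _ "\<lambda>x. x \<in> S"]) (auto simp: eventually_principal)

lemma filterlim_cdot_sector:
  assumes z: "z \<noteq> 0" and C: "C > 0"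
  shows "filterlim (\<lambda>(h, x). cdot x z / of_real h) (sector_at_top C) (at_right 0 \<times>\<^sub>F principal (W C z))"
  unfolding filterlim_iff eventually_sector_at_top
proof (intro allI impI)
  fix P
  assume "\<exists>N. \<forall>z. N \<le> Re z \<longrightarrow> \<bar>Im z\<bar> \<le> C * Re z \<longrightarrow> P z"
  then obtain N where N: "\<And>z. N \<le> Re z \<Longrightarrow> \<bar>Im z\<bar> \<le> C * Re z \<Longrightarrow> P z" by blast
  \<comment> \<open>For h < e the lower bound |z|/(C h) on the real part exceeds |N| + 1; the
    summand 1 keeps the denominator positive when N = 0.\<close>
  define e where "e = norm z / (C * (\<bar>N\<bar> + 1))"
  show "\<forall>\<^sub>F y in at_right 0 \<times>\<^sub>F principal (W C z). P (case y of (h, x) \<Rightarrow> cdot x z / of_real h)"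
  proof (rule eventually_at_right_0_times_principal)
    show "e > 0" using z C by (simp add: e_def)
    fix h :: real and x
    assume h: "0 < h" "h < e" and x: "x \<in> W C z"
    have "N * h \<le> (\<bar>N\<bar> + 1) * h" using h by (intro mult_right_mono) auto
    also have "\<dots> \<le> norm z / C"
    proof -
      have pos: "0 < C * (\<bar>N\<bar> + 1)" using C by simp
      have "h * (C * (\<bar>N\<bar> + 1)) < norm z"
        using h(2) by (simp only: e_def pos_less_divide_eq[OF pos])
      then show ?thesis
        using C by (simp add: pos_le_divide_eq mult_ac)
    qed
    also have "\<dots> \<le> Re (cdot x z)" by (rule cdot_in_W[OF x z C])
    finally have "N \<le> Re (cdot x z / of_real h)" using h by (simp add: field_simps)
    moreover have "\<bar>Im (cdot x z / of_real h)\<bar> \<le> C * Re (cdot x z / of_real h)"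
      using cdot_in_W(2)[OF x z C] h by (simp add: divide_right_mono)
    ultimately show "P (case (h, x) of (h, x) \<Rightarrow> cdot x z / of_real h)"
      using N by simp
  qed
qed

text \<open>The remainder in the sector is composed with w = (x . z)/h, and c/w = (c/(x . z)) h. As
  |x . z| \<ge> |z|/C on W, the error 1/w^2 is at most (C/|z|)^2 h^2, uniformly in x.\<close>

lemma g_expansion_on_W:
  assumes exp: "g_expansion a s C c" and z: "z \<noteq> 0" and C: "C > 0"
  shows "\<exists>E \<in> O[at_right 0 \<times>\<^sub>F principal (W C z)](\<lambda>(h, x). of_real (h\<^sup>2)).
         \<forall>\<^sub>F (h, x) in at_right 0 \<times>\<^sub>F principal (W C z).
           (deriv ^^ s) (g a) (cdot x z / of_real h) =
             of_real (sqrt a) * csqrt (cdot x z / of_real h) * exp (cdot x z / of_real h)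
               * (1 + c / cdot x z * of_real h + E (h, x))"
proof -
  let ?F = "at_right (0 :: real) \<times>\<^sub>F principal (W C z)"
  let ?w = "\<lambda>(h, x). cdot x z / complex_of_real h"
  obtain E where E: "E \<in> O[sector_at_top C](\<lambda>z. 1 / z\<^sup>2)"
    and eq: "\<forall>\<^sub>F z in sector_at_top C. (deriv ^^ s) (g a) z = of_real (sqrt a) * csqrt z * exp z * (1 + c / z + E z)"
    using exp by (auto simp: g_expansion_def)
  note lim = filterlim_cdot_sector[OF z C]
  have "(\<lambda>p. E (?w p)) \<in> O[?F](\<lambda>p. 1 / (?w p)\<^sup>2)"
    by (rule landau_o.big.compose[OF E lim])
  also have "(\<lambda>p. 1 / (?w p)\<^sup>2) \<in> O[?F](\<lambda>(h, x). complex_of_real (h\<^sup>2))"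
  proof (rule bigoI[where c = "(C / norm z)\<^sup>2"], rule eventually_at_right_0_times_principal)
    fix h :: real and x
    assume h: "0 < h" "h < 1" and x: "x \<in> W C z"
    have "norm z / C \<le> cmod (cdot x z)"
      using cdot_in_W(1)[OF x z C] complex_Re_le_cmod[of "cdot x z"] by linarith
    moreover have "0 < norm z / C" using z C by simp
    ultimately have "0 < cmod (cdot x z)" "norm z \<le> C * cmod (cdot x z)"
      using C by (linarith, simp add: field_simps)
    then have "1 / cmod (cdot x z) \<le> C / norm z"
      using z C by (simp add: field_simps)
    then have "(1 / cmod (cdot x z))\<^sup>2 * h\<^sup>2 \<le> (C / norm z)\<^sup>2 * h\<^sup>2"
      by (intro mult_right_mono power_mono) auto
    then show "norm (1 / (?w (h, x))\<^sup>2) \<le> (C / norm z)\<^sup>2 * norm (case (h, x) of (h, x) \<Rightarrow> complex_of_real (h\<^sup>2))"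
      by (simp add: norm_divide norm_power power_divide)
  qed simp
  finally have "(\<lambda>p. E (?w p)) \<in> O[?F](\<lambda>(h, x). complex_of_real (h\<^sup>2))" .
  moreover have "\<forall>\<^sub>F (h, x) in ?F.
           (deriv ^^ s) (g a) (cdot x z / of_real h) =
             of_real (sqrt a) * csqrt (cdot x z / of_real h) * exp (cdot x z / of_real h)
               * (1 + c / cdot x z * of_real h + E (?w (h, x)))"
    using filterlim_iff[THEN iffD1, OF lim, rule_format, OF eq] by (simp add: case_prod_unfold)
  ultimately show ?thesis
    by (intro bexI[of _ "\<lambda>p. E (?w p)"])
qed

lemma higher_deriv_g_bound_on_V:
  assumes a: "a > 0" and z: "z \<noteq> 0" and C: "C > 0" and \<mu>: "\<mu> = 1 / C - 1"
  shows "\<exists>C1. \<forall>\<^sub>F h in at_right 0. \<forall>x \<in> V C z.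
         cmod ((deriv ^^ s) (g a) (cdot x z / of_real h))
           \<le> C1 / h * exp (norm z / h) * exp (\<mu> * norm z / h) * (norm z / h + 1)"
proof -
  define b where "b = 1 / a + real s"
  have b: "b > 0" using a by (simp add: b_def add_pos_nonneg)
  define k where "k = sqrt a * (1 / sqrt (b + 1) + sqrt b)"
  have k: "k \<ge> 0" using a b by (simp add: k_def)
  have "cmod ((deriv ^^ s) (g a) (cdot x z / of_real h))
       \<le> k / h * exp (norm z / h) * exp (\<mu> * norm z / h) * (norm z / h + 1)"
    if h: "h \<in> {0<..<1}" and x: "x \<in> V C z" for h x
  proof -
    let ?w = "cdot x z / of_real h"
    have w: "cmod ?w \<le> norm z / h"
      using norm_cdot_le[of x z] x h by (simp add: V_def norm_divide divide_right_mono)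
    have "Re (cdot x z) \<le> norm z / C"
      using x z C by (auto simp: V_def W_def field_simps)
    from divide_right_mono[OF this, of h] have "Re ?w \<le> norm z / C / h"
      using h by simp
    \<comment> \<open>The right-hand side equals |z|/(C h), which is positive and therefore also
      dominates the value 0 in the maximum.\<close>
    then have m: "max (Re ?w) 0 \<le> norm z / h + \<mu> * norm z / h"
      using h C by (simp add: \<mu> field_simps)
    have "cmod ((deriv ^^ s) (g a) ?w) = sqrt a * cmod (sqrt_series b ?w)"
      using a by (simp add: higher_deriv_g b_def norm_mult)
    also have "\<dots> \<le> sqrt a * ((1 / sqrt (b + 1) + sqrt b) * (cmod ?w + 1) * exp (max (Re ?w) 0))"
      using a by (intro mult_left_mono norm_sqrt_series_le b) auto
    also have "\<dots> = k * ((cmod ?w + 1) * exp (max (Re ?w) 0))"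
      by (simp add: k_def)
    also have "\<dots> \<le> k / h * ((norm z / h + 1) * exp (norm z / h + \<mu> * norm z / h))"
    proof (rule mult_mono)
      \<comment> \<open>The factor 1/h of the bound comes from h < 1.\<close>
      show "k \<le> k / h" using h k by (simp add: field_simps mult_left_le_one_le)
      show "(cmod ?w + 1) * exp (max (Re ?w) 0) \<le> (norm z / h + 1) * exp (norm z / h + \<mu> * norm z / h)"
        using w m h by (intro mult_mono) auto
    qed (use h k in auto)
    also have "\<dots> = k / h * exp (norm z / h) * exp (\<mu> * norm z / h) * (norm z / h + 1)"
      by (simp add: exp_add)
    finally show ?thesis .
  qed
  then show ?thesis
    using eventually_at_right_real[of 0 1] by (intro exI[of _ k]) (auto elim: eventually_mono)
qed

section \<open>The kernel \<open>K\<close> as a value of \<open>g\<close>\<close>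

text \<open>Expanding (n-1)_{l+1} from its first and from its last factor gives (n)_l/(n-1)_l =
  (n-1+l)/(n-1).\<close>

lemma c_coeff_eq:
  assumes "n \<ge> 2"
  shows "c_coeff n l = sqrt (1 / (real n - 1) * real l + 1)"
proof -
  have "(real n - 1) * pochhammer (real n) l = (real n - 1 + real l) * pochhammer (real n - 1) l"
    using pochhammer_rec[of "real n - 1" l] pochhammer_rec'[of "real n - 1" l] by simp
  moreover have "pochhammer (real n - 1) l > 0"
    using assms by (intro pochhammer_pos) auto
  ultimately have "pochhammer (real n) l / pochhammer (real n - 1) l = 1 / (real n - 1) * real l + 1"
    using assms by (simp add: field_simps)
  then show ?thesis by (simp add: c_coeff_def)
qed

lemma K_eq_g:
  fixes x z :: "complex ^ 'n"
  assumes "CARD('n) \<ge> 2"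
  shows "K h x z = g (1 / (real CARD('n) - 1)) (cdot x z / of_real h)"
  unfolding K_def g_def c_coeff_eq[OF assms] ..

theorem proposition3p3:
  fixes a C \<mu> :: real and s :: nat and z :: "complex ^ 'n"
  assumes "0 < a" and "a \<le> 2" and "z \<noteq> 0" and "C > 1" and "\<mu> = 1 / C - 1"
  shows "g_expansion a s C (a1_coeff a s)
    \<and> (\<exists>E \<in> O[at_right 0 \<times>\<^sub>F principal (W C z)](\<lambda>(h, x). of_real (h\<^sup>2)).
         \<forall>\<^sub>F (h, x) in at_right 0 \<times>\<^sub>F principal (W C z).
           (deriv ^^ s) (g a) (cdot x z / of_real h) =
             of_real (sqrt a) * csqrt (cdot x z / of_real h) * exp (cdot x z / of_real h)
               * (1 + a1_coeff a s / cdot x z * of_real h + E (h, x)))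
    \<and> \<mu> < 0
    \<and> (\<exists>C1. \<forall>\<^sub>F h in at_right 0. \<forall>x \<in> V C z.
         cmod ((deriv ^^ s) (g a) (cdot x z / of_real h))
           \<le> C1 / h * exp (norm z / h) * exp (\<mu> * norm z / h) * (norm z / h + 1))
    \<and> (CARD('n) \<ge> 2 \<longrightarrow>
       (\<exists>E \<in> O[at_right 0 \<times>\<^sub>F principal (W C z)](\<lambda>(h, x). of_real (h\<^sup>2)).
         \<forall>\<^sub>F (h, x) in at_right 0 \<times>\<^sub>F principal (W C z).
           K h x z =
             csqrt (cdot x z / of_real (h * (real CARD('n) - 1))) * exp (cdot x z / of_real h)
               * (1 + of_real (1 / 2 * (real CARD('n) - 5 / 4)) / cdot x z * of_real h
                    + E (h, x))))"
proof (intro conjI impI)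
  have C: "C > 0" using assms by simp
  show exp: "g_expansion a s C (a1_coeff a s)"
    using g_expansion_holds a1_coeff_eq assms by simp
  show "\<exists>E \<in> O[at_right 0 \<times>\<^sub>F principal (W C z)](\<lambda>(h, x). of_real (h\<^sup>2)).
         \<forall>\<^sub>F (h, x) in at_right 0 \<times>\<^sub>F principal (W C z).
           (deriv ^^ s) (g a) (cdot x z / of_real h) =
             of_real (sqrt a) * csqrt (cdot x z / of_real h) * exp (cdot x z / of_real h)
               * (1 + a1_coeff a s / cdot x z * of_real h + E (h, x))"
    by (rule g_expansion_on_W[OF exp \<open>z \<noteq> 0\<close> C])
  show "\<mu> < 0" using assms by simp
  show "\<exists>C1. \<forall>\<^sub>F h in at_right 0. \<forall>x \<in> V C z.
         cmod ((deriv ^^ s) (g a) (cdot x z / of_real h))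
           \<le> C1 / h * exp (norm z / h) * exp (\<mu> * norm z / h) * (norm z / h + 1)"
    using higher_deriv_g_bound_on_V assms C by blast
  assume n: "CARD('n) \<ge> 2"
  define m where "m = real CARD('n) - 1"
  define c where "c = complex_of_real (1 / 2 * (real CARD('n) - 5 / 4))"
  have m: "m > 0" using n by (simp add: m_def)
  \<comment> \<open>The general coefficient at a = 1/(n-1), s = 0 is (n-1)/2 - 1/8 = (n -
    5/4)/2.\<close>
  have "complex_of_real ((1 / (1 / m) + real 0) / 2 - 1 / 8) = c"
    unfolding c_def m_def by (rule arg_cong[of _ _ of_real]) (simp add: field_simps)
  with g_expansion_holds[of "1 / m" 0 C] m have exp: "g_expansion (1 / m) 0 C c" by simp
  \<comment> \<open>The prefactor sqrt a moves under the principal root because 1/m is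
    positive.\<close>
  have "of_real (sqrt (1 / m)) * csqrt (cdot x z / of_real h) = csqrt (cdot x z / of_real (h * m))" for h x
    using csqrt_of_real_mult[of "1 / m" "cdot x z / of_real h"] m by (simp add: mult.commute)
  with g_expansion_on_W[OF exp \<open>z \<noteq> 0\<close> C]
  show "\<exists>E \<in> O[at_right 0 \<times>\<^sub>F principal (W C z)](\<lambda>(h, x). of_real (h\<^sup>2)).
         \<forall>\<^sub>F (h, x) in at_right 0 \<times>\<^sub>F principal (W C z).
           K h x z =
             csqrt (cdot x z / of_real (h * (real CARD('n) - 1))) * exp (cdot x z / of_real h)
               * (1 + of_real (1 / 2 * (real CARD('n) - 5 / 4)) / cdot x z * of_real h
                    + E (h, x))"
    unfolding K_eq_g[OF n] m_def[symmetric] c_def[symmetric] by simp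
qed

end
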